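(* Let $n,r,s$ be positive integers with $n>r$, and let $A\subset\mathbb{N}^n$ be $r$-wise $s$-union. For $1\leq i\leq n$ let $m_i=\max\{x_i:\mathbf x\in A\}$ and $\mathbf m=(m_1,\ldots,m_n)$. Assume that $n-r$ divides $|\mathbf m|-s$, that $d:=\frac{|\mathbf m|-s}{n-r}$ is non-negative, and that $a_i:=m_i-d\geq 0$ for all $1\leq i\leq n$; put $\mathbf a=(a_1,\ldots,a_n)$ (so $|\mathbf a|=s-rd$) and $P_i:=\mathbf a+d\mathbf e_i$ for $1\leq i\leq n$. Assume further that $\{P_1,\ldots,P_n\}\subset A$. Then \[ |A|\leq \max_{0\leq d'\leq\lfloor s/r\rfloor}\left|K(r,n,\mathbf a',d')\right|, \] where, for each $d'$, $\mathbf a'\in\mathbb{N}^n$ is a balanced partition with $|\mathbf a'|=s-rd'$. Moreover, if equality holds, then $A=K(r,n,\mathbf a',d')$ for some $0\leq d'\leq\lfloor s/r\rfloor$ and some balanced partition $\mathbf a'\in\mathbb{N}^n$ with $|\mathbf a'|=s-rd'$.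
   Context: $\mathbb{N}=\{0,1,2,\ldots\}$. For $\mathbf a\in\mathbb{N}^n$, $|\mathbf a|=\sum_i a_i$. The join of vectors is their componentwise maximum. $A\subset\mathbb{N}^n$ is $r$-wise $s$-union if the join of any $r$ vectors of $A$ (not necessarily distinct) has weight at most $s$. $\mathbf e_i$ is the $i$-th standard basis vector and $\mathbf 1=(1,\ldots,1)$. Write $\mathbf a\prec\mathbf b$ if $a_i\leq b_i$ for all $i$; $\mathcal{D}(\mathbf a)=\{\mathbf c\in\mathbb{N}^n:\mathbf c\prec\mathbf a\}$, $\mathcal{D}(B)=\bigcup_{\mathbf a\in B}\mathcal{D}(\mathbf a)$; $\mathcal{U}(\mathbf a,d)=\{\mathbf a+\boldsymbol\epsilon:\boldsymbol\epsilon\in\mathbb{N}^n,|\boldsymbol\epsilon|=d\}$. A vector $\mathbf a\in\mathbb{N}^n$ is a balanced partition if $|a_i-a_j|\leq 1$ for all $i,j$. For $0\leq d\leq\lfloor s/r\rfloor$ and $\mathbf a\in\mathbb{N}^n$ with $|\mathbf a|=s-rd$, with $u=n-r+1$, define \[ K(r,n,\mathbf a,d)=\bigcup_{i=0}^{\lfloor d/u\rfloor}\mathcal{D}(\mathcal{U}(\mathbf a+i\mathbf 1,d-ui)). \] *)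

theory Defs
  imports "HOL-Analysis.Analysis"
begin

text \<open>
  Vectors with \<open>n\<close> natural-number coordinates are elements of \<^typ>\<open>nat ^ 'n\<close>, with
  \<open>n = CARD('n)\<close>.  The library order \<open>a \<le> b\<close> on this type is the componentwise order, and
  \<open>axis i d\<close> is \<open>d\<close> times the \<open>i\<close>-th standard basis vector.
\<close>

definition weight :: "nat ^ 'n \<Rightarrow> nat" where
  "weight a = (\<Sum>i\<in>UNIV. a $ i)"

text \<open>Componentwise maximum; only used for finite nonempty \<open>X\<close>.\<close>

definition join :: "(nat ^ 'n) set \<Rightarrow> nat ^ 'n" where
  "join X = (\<chi> i. Max ((\<lambda>x. x $ i) ` X))"

text \<open>
  The \<open>r\<close> vectors \<open>x 0, \<dots>, x (r - 1)\<close> may repeat.  For \<open>r > 0\<close> the condition bounds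
  the weight of every element of \<open>A\<close> by \<open>s\<close>, so \<open>A\<close> is finite.
\<close>

definition wise_union :: "nat \<Rightarrow> nat \<Rightarrow> (nat ^ 'n) set \<Rightarrow> bool" where
  "wise_union r s A \<longleftrightarrow>
     (\<forall>x :: nat \<Rightarrow> nat ^ 'n. (\<forall>k<r. x k \<in> A) \<longrightarrow> weight (join (x ` {..<r})) \<le> s)"

definition down :: "(nat ^ 'n) set \<Rightarrow> (nat ^ 'n) set" where
  "down B = (\<Union>a\<in>B. {c. c \<le> a})"

definition up :: "nat ^ 'n \<Rightarrow> nat \<Rightarrow> (nat ^ 'n) set" where
  "up a d = {a + e | e. weight e = d}"

definition balanced :: "nat ^ 'n \<Rightarrow> bool" where
  "balanced a \<longleftrightarrow> (\<forall>i j. \<bar>int (a $ i) - int (a $ j)\<bar> \<le> 1)"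

text \<open>
  \<open>vec i\<close> is the constant vector \<open>(i, \<dots>, i)\<close>.  Intended for \<open>r < CARD('n)\<close>; then neither
  subtraction truncates.
\<close>

definition K :: "nat \<Rightarrow> nat ^ 'n \<Rightarrow> nat \<Rightarrow> (nat ^ 'n) set" where
  "K r a d =
     (let u = CARD('n) - r + 1
      in \<Union>i\<in>{0..d div u}. down (up (a + vec i) (d - u * i)))"

end

theory Submission
  imports Defs
begin

text \<open>
  For a vector \<open>x\<close> write \<open>y\<close> for the positive part of \<open>x - a\<close>, and \<open>u = n - r + 1\<close>.  Then
  \<open>x \<in> K r a d\<close> iff every \<open>u\<close> coordinates of \<open>y\<close> sum to at most \<open>d\<close>, and for \<open>r \<ge> 2\<close> the join
  of \<open>x\<close> with any \<open>r - 1\<close> of the \<open>P i\<close> gives exactly these inequalities for \<open>x \<in> A\<close>; so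
  \<open>A \<subseteq> K r a d\<close>.  The set \<open>T\<close> of admissible \<open>y\<close> does not depend on \<open>a\<close> and is symmetric, and the
  number of \<open>x\<close> over \<open>y\<close> is the product of \<open>a j + 1\<close> over the zeros \<open>j\<close> of \<open>y\<close>.  Pairing \<open>y\<close> with
  its image under a transposition shows that moving a unit from a larger to a smaller coordinate of
  \<open>a\<close> does not decrease \<open>card (K r a d)\<close>, and increases it if the coordinates differ by at least 2.
  For \<open>r = 1\<close> the inclusion can fail, but \<open>K 1 0 s\<close> consists of all vectors of weight at most \<open>s\<close>.
\<close>

section \<open>Finiteness, and membership in \<open>K\<close> by sums over \<open>u\<close>
  coordinates\<close>

lemma finite_vec_le: "finite {x :: nat ^ 'n. x \<le> a}"
proof (rule finite_subset)
  show "{x. x \<le> a} \<subseteq> vec_lambda ` (\<Pi>\<^sub>E i\<in>UNIV. {..a $ i})"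
  proof
    fix x assume "x \<in> {x. x \<le> a}"
    then have "vec_nth x \<in> (\<Pi>\<^sub>E i\<in>UNIV. {..a $ i})"
      by (auto simp: less_eq_vec_def)
    then show "x \<in> vec_lambda ` (\<Pi>\<^sub>E i\<in>UNIV. {..a $ i})"
      by (metis image_eqI vec_nth_inverse)
  qed
  show "finite (vec_lambda ` (\<Pi>\<^sub>E i\<in>UNIV. {..a $ i}))"
    by (intro finite_imageI finite_PiE) auto
qed

definition T :: "nat \<Rightarrow> nat \<Rightarrow> (nat ^ 'n) set" where
  "T u d = {y. \<forall>J. card J = u \<longrightarrow> (\<Sum>j\<in>J. y $ j) \<le> d}"

definition pos_diff :: "nat ^ 'n \<Rightarrow> nat ^ 'n \<Rightarrow> nat ^ 'n" where
  "pos_diff a x = (\<chi> j. x $ j - a $ j)"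

text \<open>Since \<open>0 < u \<le> CARD('n)\<close>, every coordinate lies in some
  \<open>u\<close>-element set, so it is at most \<open>d\<close>.\<close>

lemma finite_T:
  assumes "0 < u" "u \<le> CARD('n)"
  shows "finite (T u d :: (nat ^ 'n) set)"
proof (rule finite_subset[OF _ finite_vec_le])
  show "T u d \<subseteq> {y :: nat ^ 'n. y \<le> vec d}"
  proof (clarsimp simp: less_eq_vec_def)
    fix y :: "nat ^ 'n" and j assume y: "y \<in> T u d"
    obtain J :: "'n set" where J: "{j} \<subseteq> J" "card J = u"
      using exists_subset_between[of "{j}" u UNIV] assms by auto
    have "y $ j \<le> (\<Sum>j\<in>J. y $ j)"
      using J by (intro member_le_sum) auto
    then show "y $ j \<le> d" using y J by (force simp: T_def)
  qed
qed

text \<open>\<open>J\<close> collects positions of \<open>u\<close> largest values and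
  \<open>i\<close> separates them from the rest. For the least \<open>i\<close> with at most
  \<open>u\<close> values above it, at least \<open>u\<close> values are \<open>\<ge> i\<close>, so
  \<open>J\<close> fits in between.\<close>

lemma threshold_subset:
  fixes y :: "'n::finite \<Rightarrow> nat"
  assumes "u \<le> CARD('n)"
  obtains i J where "card J = u" "\<And>j. j \<in> J \<Longrightarrow> i \<le> y j" "\<And>j. j \<notin> J \<Longrightarrow> y j \<le> i"
proof -
  define Q where "Q i \<longleftrightarrow> card {j. i < y j} \<le> u" for i
  define i where "i = (LEAST i. Q i)"
  have "Q (Max (range y))"
    by (simp add: Q_def leD)
  then have Qi: "Q i" unfolding i_def by (rule LeastI)
  have "u \<le> card {j. i \<le> y j}"
  proof (cases i)
    case 0
    then show ?thesis using assms by simp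
  next
    case (Suc k)
    then have "\<not> Q k" using not_less_Least[of k Q] by (simp add: i_def)
    then show ?thesis by (simp add: Q_def Suc Suc_le_eq)
  qed
  then obtain J where "{j. i < y j} \<subseteq> J" "J \<subseteq> {j. i \<le> y j}" "card J = u"
    using exists_subset_between[of "{j. i < y j}" u "{j. i \<le> y j}"] Qi
    by (force simp: Q_def)
  then show thesis
    by (intro that[of J i]) (auto simp: subset_iff not_less[symmetric])
qed

text \<open>In the piece with index \<open>i\<close>, any \<open>u\<close> coordinates of
  \<open>y\<close> sum to at most \<open>u * i + weight e = d\<close>. Conversely, the threshold of
  the \<open>u\<close> largest coordinates of \<open>y\<close> serves as the index
  \<open>i\<close>.\<close>

lemma K_altdef:
  fixes a :: "nat ^ 'n"
  assumes "0 < r" "r < CARD('n)"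
  defines "u \<equiv> CARD('n) - r + 1"
  shows "K r a d = {x. pos_diff a x \<in> T u d}"
proof (intro set_eqI iffI; unfold mem_Collect_eq)
  fix x :: "nat ^ 'n" assume "x \<in> K r a d"
  then obtain i e where i: "i \<le> d div u" and e: "weight e = d - u * i"
    and x: "x \<le> a + vec i + e"
    by (auto simp: K_def u_def Let_def down_def up_def)
  have ui: "u * i \<le> d"
    using i by (metis dual_order.trans mult.commute mult_le_mono1 times_div_less_eq_dividend)
  have xj: "x $ j \<le> a $ j + i + e $ j" for j
    using x by (simp add: less_eq_vec_def)
  show "pos_diff a x \<in> T u d"
    unfolding T_def
  proof (intro CollectI allI impI)
    fix J :: "'n set" assume J: "card J = u"
    have "(\<Sum>j\<in>J. pos_diff a x $ j) \<le> (\<Sum>j\<in>J. i + e $ j)"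
    proof (rule sum_mono)
      fix j show "pos_diff a x $ j \<le> i + e $ j"
        using xj[of j] by (simp add: pos_diff_def)
    qed
    also have "\<dots> = u * i + (\<Sum>j\<in>J. e $ j)" by (simp add: sum.distrib J)
    also have "(\<Sum>j\<in>J. e $ j) \<le> weight e"
      unfolding weight_def by (rule sum_mono2) auto
    finally show "(\<Sum>j\<in>J. pos_diff a x $ j) \<le> d" using e ui by simp
  qed
next
  fix x :: "nat ^ 'n" assume y: "pos_diff a x \<in> T u d"
  define y where "y = vec_nth (pos_diff a x)"
  have u: "u \<le> CARD('n)" "0 < u" using assms by auto
  obtain i J where J: "card J = u" "\<And>j. j \<in> J \<Longrightarrow> i \<le> y j" "\<And>j. j \<notin> J \<Longrightarrow> y j \<le> i"
    using threshold_subset[OF u(1)] by metis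
  \<comment> \<open>Entries outside \<open>J\<close> have no excess over \<open>i\<close>, and on
    \<open>J\<close> the subtraction is exact, so the total excess is the sum of \<open>y\<close>
    over \<open>J\<close> minus \<open>u * i\<close>.\<close>
  have "(\<Sum>j\<in>UNIV. y j - i) = (\<Sum>j\<in>J. y j - i)"
    using J(3) by (intro sum.mono_neutral_right) auto
  moreover have "(\<Sum>j\<in>J. y j) = (\<Sum>j\<in>J. (y j - i) + i)"
    using J(2) by (intro sum.cong) auto
  moreover have "(\<Sum>j\<in>J. y j) \<le> d"
    using y J(1) by (auto simp: T_def y_def)
  ultimately have S: "(\<Sum>j\<in>UNIV. y j - i) + u * i \<le> d"
    by (simp add: sum.distrib J(1))
  \<comment> \<open>\<open>up\<close> asks for weight exactly \<open>d - u * i\<close>; the slack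
    \<open>c\<close> goes to an arbitrary coordinate \<open>k\<close>.\<close>
  define k :: 'n where "k = undefined"
  define c where "c = d - u * i - (\<Sum>j\<in>UNIV. y j - i)"
  define e :: "nat ^ 'n" where "e = (\<chi> j. (y j - i) + (if j = k then c else 0))"
  have "weight e = d - u * i"
    using S by (simp add: weight_def e_def sum.distrib c_def)
  moreover have "x \<le> a + vec i + e"
    by (auto simp: less_eq_vec_def e_def y_def pos_diff_def)
  moreover have "i \<le> d div u"
    using S u by (simp add: less_eq_div_iff_mult_less_eq mult.commute)
  ultimately show "x \<in> K r a d"
    by (force simp: K_def u_def Let_def down_def up_def)
qed

subsection \<open>Counting\<close>

definition fibre_size :: "nat ^ 'n \<Rightarrow> nat ^ 'n \<Rightarrow> nat" where
  "fibre_size a y = (\<Prod>j\<in>UNIV. if y $ j = 0 then a $ j + 1 else 1)"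

lemma fibre_pos_diff:
  "{x :: nat ^ 'n. pos_diff a x = y} =
    vec_lambda ` (\<Pi>\<^sub>E j\<in>UNIV. if y $ j = 0 then {..a $ j} else {a $ j + y $ j})" (is "?L = vec_lambda ` ?R")
proof (intro set_eqI iffI)
  fix x assume "x \<in> ?L"
  then have y: "x $ j - a $ j = y $ j" for j
    by (auto simp: pos_diff_def)
  have "x $ j \<in> (if y $ j = 0 then {..a $ j} else {a $ j + y $ j})" for j
    using y[of j] by auto
  then have "vec_nth x \<in> ?R" by (intro PiE_I) (simp_all only: UNIV_I not_True_eq_False)
  then show "x \<in> vec_lambda ` ?R"
    by (rule image_eqI[where x = "vec_nth x", rotated]) simp
next
  fix x assume "x \<in> vec_lambda ` ?R"
  then obtain f where f: "x = vec_lambda f" "f \<in> ?R" by blast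
  have "f j - a $ j = y $ j" for j
    using PiE_mem[OF f(2), of j] by (cases "y $ j = 0") simp_all
  then show "x \<in> ?L"
    by (simp add: f(1) pos_diff_def vec_eq_iff)
qed

lemma card_fibre_pos_diff: "card {x. pos_diff a x = y} = fibre_size a y"
proof -
  have "inj vec_lambda" by (metis injI vec_lambda_inverse UNIV_I)
  then show ?thesis
    unfolding fibre_pos_diff
    by (subst card_image) (auto simp: card_PiE fibre_size_def if_distrib cong: if_cong intro: inj_on_subset)
qed

lemma finite_fibre_pos_diff: "finite {x. pos_diff a x = y}"
  by (rule card_ge_0_finite) (simp add: card_fibre_pos_diff fibre_size_def)

lemma K_eq_UN_fibres:
  fixes a :: "nat ^ 'n"
  assumes "0 < r" "r < CARD('n)"
  shows "K r a d = (\<Union>y\<in>T (CARD('n) - r + 1) d. {x. pos_diff a x = y})"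
  using K_altdef[OF assms] by auto

lemma finite_K:
  fixes a :: "nat ^ 'n"
  assumes "0 < r" "r < CARD('n)"
  shows "finite (K r a d)"
  using assms by (auto simp: K_eq_UN_fibres intro!: finite_T finite_fibre_pos_diff)

lemma card_K:
  fixes a :: "nat ^ 'n"
  assumes "0 < r" "r < CARD('n)"
  shows "card (K r a d) = (\<Sum>y\<in>T (CARD('n) - r + 1) d. fibre_size a y)"
  unfolding K_eq_UN_fibres[OF assms] card_fibre_pos_diff[symmetric]
  using assms by (intro card_UN_disjoint finite_T ballI finite_fibre_pos_diff) auto

section \<open>Transpositions, and moving a unit between two coordinates\<close>

definition swap_vec :: "'n \<Rightarrow> 'n \<Rightarrow> nat ^ 'n \<Rightarrow> nat ^ 'n" where
  "swap_vec i k y = (\<chi> j. y $ Transposition.transpose i k j)"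

lemma swap_vec_swap_vec [simp]: "swap_vec i k (swap_vec i k y) = y"
  by (simp add: swap_vec_def vec_eq_iff)

lemma swap_vec_in_T:
  fixes y :: "nat ^ 'n"
  assumes "y \<in> T u d" shows "swap_vec i k y \<in> T u d"
  unfolding T_def
proof (intro CollectI allI impI)
  fix J :: "'n set" assume J: "card J = u"
  have inj: "inj_on (Transposition.transpose i k) J" by simp
  have "(\<Sum>j\<in>J. swap_vec i k y $ j) = (\<Sum>j\<in>Transposition.transpose i k ` J. y $ j)"
    by (simp add: swap_vec_def sum.reindex[OF inj])
  also have "\<dots> \<le> d"
    using assms J by (simp add: T_def card_image[OF inj])
  finally show "(\<Sum>j\<in>J. swap_vec i k y $ j) \<le> d" .
qed

lemma swap_vec_image_T: "swap_vec i k ` T u d = T u d"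
  by (metis (no_types, lifting) image_subset_iff subsetI subset_antisym swap_vec_in_T swap_vec_swap_vec image_eqI)

text \<open>The transposition permutes \<open>T\<close>, so the sum for
  \<open>card (K r a d)\<close> can be reindexed by it; adding both forms pairs each
  \<open>y\<close> with its image without splitting \<open>T\<close> into orbits.\<close>

lemma double_card_K:
  fixes a :: "nat ^ 'n"
  assumes "0 < r" "r < CARD('n)"
  shows "2 * card (K r a d) =
    (\<Sum>y\<in>T (CARD('n) - r + 1) d. fibre_size a y + fibre_size a (swap_vec i k y))"
proof -
  let ?T = "T (CARD('n) - r + 1) d :: (nat ^ 'n) set"
  have "inj_on (swap_vec i k) ?T" by (metis inj_onI swap_vec_swap_vec)
  then have "(\<Sum>y\<in>?T. fibre_size a y) = (\<Sum>y\<in>?T. fibre_size a (swap_vec i k y))"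
    using sum.reindex[of "swap_vec i k" ?T "fibre_size a"] by (simp add: swap_vec_image_T)
  then show ?thesis by (simp add: card_K[OF assms] sum.distrib)
qed

text \<open>Meant for \<open>a $ k < a $ i\<close>: then \<open>i \<noteq> k\<close> and
  \<open>a $ i - 1\<close> does not truncate.\<close>

definition shift_unit :: "'n \<Rightarrow> 'n \<Rightarrow> nat ^ 'n \<Rightarrow> nat ^ 'n" where
  "shift_unit i k a = (\<chi> j. if j = i then a $ j - 1 else if j = k then a $ j + 1 else a $ j)"

lemma fibre_size_split:
  assumes "i \<noteq> k"
  shows "fibre_size a y = (if y $ i = 0 then a $ i + 1 else 1) * (if y $ k = 0 then a $ k + 1 else 1)
    * (\<Prod>j\<in>UNIV - {i, k}. if y $ j = 0 then a $ j + 1 else 1)"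
proof -
  have "UNIV = insert i (insert k (UNIV - {i, k}))" by auto
  then have "fibre_size a y =
    (\<Prod>j\<in>insert i (insert k (UNIV - {i, k})). if y $ j = 0 then a $ j + 1 else 1)"
    by (simp add: fibre_size_def)
  then show ?thesis using assms by (simp add: mult.assoc)
qed

text \<open>With \<open>a $ i = a $ k + 1 + t\<close>, right side minus left side is
  \<open>2 * t\<close> times the product over the other coordinates if \<open>y\<close> vanishes at
  both \<open>i\<close> and \<open>k\<close>, and zero otherwise.\<close>

lemma fibre_size_pair_le:
  fixes a y :: "nat ^ 'n"
  assumes lt: "a $ k < a $ i"
  shows "fibre_size a y + fibre_size a (swap_vec i k y)
    \<le> fibre_size (shift_unit i k a) y + fibre_size (shift_unit i k a) (swap_vec i k y)" (is "?le y")
    and "a $ k + 1 < a $ i \<Longrightarrow> fibre_size a 0 + fibre_size a (swap_vec i k 0)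
    < fibre_size (shift_unit i k a) 0 + fibre_size (shift_unit i k a) (swap_vec i k 0)"
proof -
  have ik: "i \<noteq> k" using lt by auto
  define p where "p y = (\<Prod>j\<in>UNIV - {i, k}. if y $ j = 0 then a $ j + 1 else 1)" for y :: "nat ^ 'n"
  have p': "(\<Prod>j\<in>UNIV - {i, k}. if y $ j = 0 then shift_unit i k a $ j + 1 else 1) = p y" for y
    unfolding p_def by (intro prod.cong) (auto simp: shift_unit_def)
  have ps: "p (swap_vec i k y) = p y" for y
    unfolding p_def by (intro prod.cong) (auto simp: swap_vec_def)
  have s: "swap_vec i k y $ i = y $ k" "swap_vec i k y $ k = y $ i" for y
    by (auto simp: swap_vec_def)
  have b: "shift_unit i k a $ i = a $ i - 1" "shift_unit i k a $ k = a $ k + 1"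
    using ik by (auto simp: shift_unit_def)
  obtain t where t: "a $ i = a $ k + 1 + t"
    using lt by (metis Suc_eq_plus1 add_Suc_right less_iff_Suc_add add.commute)
  note split = fibre_size_split[OF ik, of a, folded p_def]
    fibre_size_split[OF ik, of "shift_unit i k a", unfolded p'] ps s b t
  show "?le y"
    unfolding split distrib_right[symmetric]
    by (rule mult_right_mono) (auto simp: algebra_simps)
  assume "a $ k + 1 < a $ i"
  then have "0 < t" using t by simp
  moreover have "0 < p 0" by (simp add: p_def prod_pos)
  ultimately show "fibre_size a 0 + fibre_size a (swap_vec i k 0)
    < fibre_size (shift_unit i k a) 0 + fibre_size (shift_unit i k a) (swap_vec i k 0)"
    unfolding split distrib_right[symmetric]
    by (intro mult_strict_right_mono) (auto simp: algebra_simps)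
qed

lemma card_K_shift_unit_le:
  fixes a :: "nat ^ 'n"
  assumes "0 < r" "r < CARD('n)" "a $ k < a $ i"
  shows "card (K r a d) \<le> card (K r (shift_unit i k a) d)"
proof -
  have "2 * card (K r a d) \<le> 2 * card (K r (shift_unit i k a) d)"
    unfolding double_card_K[OF assms(1,2), of _ _ i k]
    by (intro sum_mono fibre_size_pair_le assms)
  then show ?thesis by simp
qed

lemma card_K_shift_unit_less:
  fixes a :: "nat ^ 'n"
  assumes "0 < r" "r < CARD('n)" "a $ k + 1 < a $ i"
  shows "card (K r a d) < card (K r (shift_unit i k a) d)"
proof -
  have "2 * card (K r a d) < 2 * card (K r (shift_unit i k a) d)"
    unfolding double_card_K[OF assms(1,2), of _ _ i k]
  proof (rule sum_strict_mono_ex1)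
    show "finite (T (CARD('n) - r + 1) d :: (nat ^ 'n) set)"
      using assms by (intro finite_T) auto
    \<comment> \<open>The zero vector lies in every \<open>T\<close>, so a strictly increasing pair
      always occurs.\<close>
    have "(0 :: nat ^ 'n) \<in> T (CARD('n) - r + 1) d" by (simp add: T_def)
    with fibre_size_pair_le(2)[of a k i] assms(3)
    show "\<exists>y\<in>T (CARD('n) - r + 1) d. fibre_size a y + fibre_size a (swap_vec i k y)
      < fibre_size (shift_unit i k a) y + fibre_size (shift_unit i k a) (swap_vec i k y)"
      by (intro bexI[of _ 0]) auto
  qed (use assms(3) in \<open>auto intro!: fibre_size_pair_le\<close>)
  then show ?thesis by simp
qed

section \<open>Comparison with balanced vectors\<close>

lemma weight_shift_unit:
  assumes "a $ k < a $ i"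
  shows "weight (shift_unit i k a) = weight a"
proof -
  have ik: "i \<noteq> k" using assms by auto
  have U: "UNIV = insert i (insert k (UNIV - {i, k}))" by auto
  have "(\<Sum>j\<in>UNIV - {i, k}. shift_unit i k a $ j) = (\<Sum>j\<in>UNIV - {i, k}. a $ j)"
    by (intro sum.cong) (auto simp: shift_unit_def)
  then have "(\<Sum>j\<in>insert i (insert k (UNIV - {i, k})). shift_unit i k a $ j)
      = (\<Sum>j\<in>insert i (insert k (UNIV - {i, k})). a $ j)"
    using ik assms by (simp add: shift_unit_def)
  then show ?thesis unfolding weight_def U[symmetric] .
qed

text \<open>Induction on the total excess of \<open>a\<close> over \<open>b\<close>: a unit moves
  from a coordinate where \<open>a\<close> exceeds \<open>b\<close> to one where it falls
  short.\<close>

lemma card_K_le_balanced: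
  fixes a b :: "nat ^ 'n"
  assumes "0 < r" "r < CARD('n)" and b: "balanced b" and "weight a = weight b"
  shows "card (K r a d) \<le> card (K r b d)"
  using \<open>weight a = weight b\<close>
proof (induction "\<Sum>j\<in>UNIV. a $ j - b $ j" arbitrary: a rule: less_induct)
  case less
  show ?case
  proof (cases "a = b")
    case False
    have "\<exists>i. b $ i < a $ i"
    proof (rule ccontr)
      assume "\<nexists>i. b $ i < a $ i"
      then have le: "\<And>i. a $ i \<le> b $ i" by (simp add: not_less)
      moreover obtain j where "a $ j \<noteq> b $ j" using False by (auto simp: vec_eq_iff)
      ultimately have "weight a < weight b"
        unfolding weight_def by (intro sum_strict_mono_ex1) (auto intro: le_neq_implies_less)
      then show False using less.prems by simp
    qed
    then obtain i where i: "b $ i < a $ i" by blast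
    have "\<exists>k. a $ k < b $ k"
    proof (rule ccontr)
      assume "\<nexists>k. a $ k < b $ k"
      then have "weight b < weight a"
        using i unfolding weight_def by (intro sum_strict_mono_ex1) (auto simp: not_less)
      then show False using less.prems by simp
    qed
    then obtain k where k: "a $ k < b $ k" by blast
    \<comment> \<open>Balancedness gives
      \<open>a $ k < b $ k \<le> b $ i + 1 \<le> a $ i\<close>.\<close>
    have "\<bar>int (b $ k) - int (b $ i)\<bar> \<le> 1" using b by (simp add: balanced_def)
    then have lt: "a $ k < a $ i" using i k by linarith
    \<comment> \<open>The excess at \<open>i\<close> drops by one, and \<open>k\<close> still has
      none because \<open>a $ k < b $ k\<close>.\<close>
    have "(\<Sum>j\<in>UNIV. shift_unit i k a $ j - b $ j) < (\<Sum>j\<in>UNIV. a $ j - b $ j)"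
      using i k by (intro sum_strict_mono_ex1) (auto simp: shift_unit_def intro!: exI[of _ i])
    then have "card (K r (shift_unit i k a) d) \<le> card (K r b d)"
      using less.hyps less.prems by (simp add: weight_shift_unit[OF lt])
    with card_K_shift_unit_le[OF assms(1,2) lt] show ?thesis by (rule order_trans)
  qed simp
qed

text \<open>Two coordinates differ by at least 2, so one move between them already gains
  strictly.\<close>

lemma card_K_less_balanced:
  fixes a b :: "nat ^ 'n"
  assumes "0 < r" "r < CARD('n)" "balanced b" "weight a = weight b" "\<not> balanced a"
  shows "card (K r a d) < card (K r b d)"
proof -
  obtain i k where ik: "a $ k + 1 < a $ i"
  proof -
    obtain i k where "\<bar>int (a $ i) - int (a $ k)\<bar> > 1"
      using assms(5) by (auto simp: balanced_def not_le)
    then have "a $ k + 1 < a $ i \<or> a $ i + 1 < a $ k" by linarith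
    then show thesis using that by blast
  qed
  have "card (K r a d) < card (K r (shift_unit i k a) d)"
    by (rule card_K_shift_unit_less[OF assms(1,2) ik])
  also have "\<dots> \<le> card (K r b d)"
    using assms ik by (intro card_K_le_balanced) (auto simp: weight_shift_unit)
  finally show ?thesis .
qed

subsection \<open>Inclusion\<close>

lemma wise_union_weight_join_le:
  assumes "wise_union r s A" "X \<subseteq> A" "finite X" "X \<noteq> {}" "card X \<le> r"
  shows "weight (join X) \<le> s"
proof -
  obtain f where f: "f ` {..<card X} = X"
    using ex_bij_betw_nat_finite[OF \<open>finite X\<close>]
    by (metis atLeast0LessThan bij_betw_imp_surj_on)
  \<comment> \<open>Repeating \<open>f 0\<close> pads the enumeration of \<open>X\<close> to length
    \<open>r\<close>.\<close>
  define g where "g k = (if k < card X then f k else f 0)" for k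
  have "0 < card X" using assms by (simp add: card_gt_0_iff)
  then have "g ` {..<r} = X"
    using f \<open>card X \<le> r\<close> by (force simp: g_def image_iff)
  moreover from this have "\<forall>k<r. g k \<in> A" using assms by blast
  ultimately show ?thesis using assms(1) by (metis wise_union_def)
qed

lemma wise_union_weight_le:
  assumes "wise_union r s A" "0 < r" "x \<in> A"
  shows "weight x \<le> s"
proof -
  have "join {x} = x" by (simp add: join_def vec_eq_iff)
  then show ?thesis
    using wise_union_weight_join_le[of r s A "{x}"] assms by simp
qed

text \<open>The join of \<open>x\<close> with the \<open>r - 1\<close> vectors
  \<open>a + axis i d\<close>, \<open>i \<notin> J\<close>, is at least \<open>a $ j + d\<close> off
  \<open>J\<close> and at least \<open>max (a $ j) (x $ j)\<close> on \<open>J\<close>. Comparing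
  its weight with \<open>s = weight a + r * d\<close> leaves at most \<open>d\<close> for the sum of
  \<open>y\<close> over \<open>J\<close>.\<close>

lemma wise_union_subset_K:
  fixes a :: "nat ^ 'n"
  assumes A: "wise_union r s A" and "2 \<le> r" "r < CARD('n)"
    and P: "\<And>i. a + axis i d \<in> A" and w: "weight a + r * d = s"
  shows "A \<subseteq> K r a d"
proof
  fix x assume x: "x \<in> A"
  let ?y = "pos_diff a x"
  have "?y \<in> T (CARD('n) - r + 1) d"
    unfolding T_def
  proof (intro CollectI allI impI)
    fix J :: "'n set" assume J: "card J = CARD('n) - r + 1"
    have cJ: "card (- J) = r - 1"
      using J assms by (simp add: Compl_eq_Diff_UNIV card_Diff_subset)
    \<comment> \<open>Here \<open>2 \<le> r\<close> matters: some \<open>a + axis i0 d\<close> takes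
      part in the join and secures \<open>a $ j\<close> on \<open>J\<close> even where
      \<open>x $ j < a $ j\<close>.\<close>
    then have "- J \<noteq> {}" using assms by (metis card.empty diff_is_0_eq not_less_eq_eq numeral_2_eq_2 One_nat_def)
    then obtain i0 where i0: "i0 \<notin> J" by blast
    define X where "X = insert x ((\<lambda>i. a + axis i d) ` (- J))"
    have fin: "finite X" by (simp add: X_def)
    have "card X \<le> r"
      using card_insert_le_m1[of r "(\<lambda>i. a + axis i d) ` (- J)" x] card_image_le[of "- J" "\<lambda>i. a + axis i d"] assms cJ
      by (simp add: X_def)
    then have wX: "weight (join X) \<le> s"
      using x P by (intro wise_union_weight_join_le[OF A]) (auto simp: X_def)
    have ge: "z $ j \<le> join X $ j" if "z \<in> X" for z j
      unfolding join_def using that fin by (auto intro!: Max_ge)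
    have "a $ j + (if j \<in> J then ?y $ j else d) \<le> join X $ j" for j
    proof (cases "j \<in> J")
      case True
      have "a $ j \<le> join X $ j"
        using ge[of "a + axis i0 d" j] i0 by (auto simp: X_def)
      then show ?thesis using ge[of x j] True by (simp add: X_def pos_diff_def)
    next
      case False
      then show ?thesis using ge[of "a + axis j d" j] by (simp add: X_def)
    qed
    then have "(\<Sum>j\<in>UNIV. a $ j + (if j \<in> J then ?y $ j else d)) \<le> weight (join X)"
      unfolding weight_def by (intro sum_mono)
    moreover have "(\<Sum>j\<in>UNIV. a $ j + (if j \<in> J then ?y $ j else d))
        = weight a + ((\<Sum>j\<in>J. ?y $ j) + (r - 1) * d)"
      by (simp add: sum.distrib weight_def sum.If_cases cJ Collect_neg_eq)
    ultimately have "(\<Sum>j\<in>J. ?y $ j) + (r - 1) * d \<le> r * d" using w wX by linarith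
    then show "(\<Sum>j\<in>J. ?y $ j) \<le> d" using \<open>2 \<le> r\<close> by (cases r) auto
  qed
  then show "x \<in> K r a d" using assms by (simp add: K_altdef)
qed

text \<open>For \<open>a = 0\<close> the positive part of \<open>x - a\<close> is \<open>x\<close>,
  and no partial sum exceeds the weight.\<close>

lemma weight_le_subset_K_1:
  assumes "1 < CARD('n)"
  shows "{x :: nat ^ 'n. weight x \<le> s} \<subseteq> K 1 0 s"
proof clarify
  fix x :: "nat ^ 'n" assume "weight x \<le> s"
  then have "(\<Sum>j\<in>J. x $ j) \<le> s" for J
    unfolding weight_def by (rule order_trans[rotated]) (auto intro!: sum_mono2)
  then show "x \<in> K 1 0 s"
    using assms by (simp add: K_altdef T_def pos_diff_def)
qed

section \<open>The bound and the equality case\<close>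

theorem theorem2:
  fixes r s d :: nat
    and A :: "(nat ^ 'n) set"
    and m a :: "nat ^ 'n"
    and P :: "'n \<Rightarrow> nat ^ 'n"
    and b :: "nat \<Rightarrow> nat ^ 'n"
  assumes "0 < r" and "0 < s" and "r < CARD('n)"
    and "wise_union r s A"
    and "\<And>i. m $ i = Max {x $ i | x. x \<in> A}"
    and "(int CARD('n) - int r) dvd (int (weight m) - int s)"
    and "int d = (int (weight m) - int s) div (int CARD('n) - int r)"
    and "\<And>i. int (a $ i) = int (m $ i) - int d"
    and "\<And>i. P i = a + axis i d"
    and "range P \<subseteq> A"
    and "\<And>d'. d' \<le> s div r \<Longrightarrow> balanced (b d') \<and> weight (b d') = s - r * d'"
  shows "card A \<le> Max {card (K r (b d') d') | d'. d' \<le> s div r}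
    \<and> (card A = Max {card (K r (b d') d') | d'. d' \<le> s div r} \<longrightarrow>
        (\<exists>d' a'. d' \<le> s div r \<and> balanced a' \<and> weight a' = s - r * d' \<and> A = K r a' d'))"
proof -
  note r = \<open>0 < r\<close> \<open>r < CARD('n)\<close>
  let ?M = "{card (K r (b d') d') | d'. d' \<le> s div r}"
  have M_le: "card (K r (b d') d') \<le> Max ?M" if "d' \<le> s div r" for d'
    using that by (intro Max_ge) auto
  \<comment> \<open>One inclusion \<open>A \<subseteq> K r a' d'\<close> suffices: it gives a chain
    from \<open>card A\<close> through \<open>card (K r a' d')\<close> and
    \<open>card (K r (b d') d')\<close> to the maximum. Equality collapses the chain, so the strict
    comparison makes \<open>a'\<close> balanced, and finiteness gives
    \<open>A = K r a' d'\<close>.\<close>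
  have main: ?thesis
    if d': "d' \<le> s div r" and sub: "A \<subseteq> K r a' d'" and w: "weight a' = s - r * d'" for d' a'
  proof -
    have b: "balanced (b d')" "weight a' = weight (b d')" using assms(11)[OF d'] w by auto
    have 1: "card A \<le> card (K r a' d')" by (rule card_mono[OF finite_K[OF r] sub])
    have 2: "card (K r a' d') \<le> card (K r (b d') d')" by (rule card_K_le_balanced[OF r b])
    note 3 = M_le[OF d']
    have "balanced a' \<and> A = K r a' d'" if eq: "card A = Max ?M"
    proof
      show "balanced a'"
        using card_K_less_balanced[OF r b, of d'] 1 2 3 eq by linarith
      show "A = K r a' d'"
        using 1 2 3 eq by (intro card_subset_eq[OF finite_K[OF r] sub]) linarith
    qed
    with 1 2 3 d' w show ?thesis by (blast intro: order_trans)
  qed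
  show ?thesis
  proof (cases "r = 1")
    case True
    \<comment> \<open>For \<open>r = 1\<close> the choice is \<open>d' = s\<close> and
      \<open>a' = 0\<close>, of the required weight \<open>s - 1 * s\<close>.\<close>
    have "A \<subseteq> K 1 0 s"
      using wise_union_weight_le[OF assms(4,1)] weight_le_subset_K_1[where 'n='n, of s] r True by auto
    then show ?thesis using True by (intro main[of s 0]) (auto simp: weight_def)
  next
    case False
    \<comment> \<open>Divisibility makes the quotient \<open>d\<close> exact; with the sum of the
      \<open>a $ i\<close> this yields \<open>weight a + r * d = s\<close>. Working in
      \<open>int\<close> excludes truncation.\<close>
    have "int d * (int CARD('n) - int r) = int (weight m) - int s"
      using assms(6,7) by simp
    moreover have "int (weight a) = int (weight m) - int CARD('n) * int d"
      using assms(8) by (simp add: weight_def sum_subtractf)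
    ultimately have "int (weight a) + int r * int d = int s" by (simp add: algebra_simps)
    then have w: "weight a + r * d = s" by (metis of_nat_add of_nat_mult of_nat_eq_iff)
    have "A \<subseteq> K r a d"
      using assms(4,9,10) r False w by (intro wise_union_subset_K[of r s]) auto
    moreover have "d \<le> s div r"
      using w r by (simp add: less_eq_div_iff_mult_less_eq mult.commute)
    ultimately show ?thesis using w by (intro main[of d a]) auto
  qed
qed

end
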